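(* Let $\mathcal{G}=\langle \mathit{Init},\mathit{Safe},\mathit{Reach},\mathit{Goal}\rangle$ be a reachability game in which the domains of all variables are finite. Then the procedure $\operatorname{Reach}(\mathcal{G})$ (described in the context) terminates.
   Context: Setting. Fix a logic $\mathcal{L}$ and a finite set of variables $\mathcal{V}$, each $v$ with a domain $\mathcal{D}(v)$, primed copies $\mathcal{V}'$, and a Boolean variable $\mathbf{r}\in\mathcal{V}$; $\varphi[\mathcal{V}/\mathcal{V}']$ primes all variables, $\varphi[\mathcal{V}'/\mathcal{V}]$ unprimes them. A state is a valuation of $\mathcal{V}$ respecting domains. A reachability game $\langle \mathit{Init},\mathit{Safe},\mathit{Reach},\mathit{Goal}\rangle$ has state predicates (formulas over $\mathcal{V}$) $\mathit{Init},\mathit{Goal}$ and transition predicates (formulas over $\mathcal{V}\cup\mathcal{V}'$) $\mathit{Safe},\mathit{Reach}$ with $\mathit{Safe}\Rightarrow\neg\mathbf{r}$, $\mathit{Reach}\Rightarrow\mathbf{r}$ valid. A reachability strategy, winning, and symbolic strategies are as usual; only the procedure matters for termination. Satisfiability checks, interpolation, and quantifier elimination are treated as oracle calls that always return. Operators. $\operatorname{Pre}(T)=\exists\mathcal{V}'.T$, $\operatorname{Post}(T)=\exists\mathcal{V}.T$, $\operatorname{Instantiate}(\varphi,\mathcal{G})=(\mathit{Safe}\lor\mathit{Reach})\land\neg\varphi\land\varphi[\mathcal{V}/\mathcal{V}']$, $\operatorname{Enf}(T,\mathcal{G})=(\mathit{Safe}\lor\mathit{Reach})\land T\land\neg\exists\mathcal{V}'.(\mathit{Safe}\land\neg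 T)$. $\operatorname{Interpolate}$ is any fixed function that, given formulas $\alpha,\beta$ with $\alpha\land\beta$ unsatisfiable, returns a formula $\theta$ with $\beta\Rightarrow\theta$ valid, $\theta\land\alpha$ unsatisfiable, and only variables shared by $\alpha,\beta$. $\operatorname{combine}(A,F,B):=(\operatorname{Pre}(B)\Rightarrow B)\land((\neg\operatorname{Pre}(B)\land\operatorname{Pre}(F))\Rightarrow F)\land((\neg\operatorname{Pre}(B)\land\neg\operatorname{Pre}(F))\Rightarrow A)\land(\operatorname{Pre}(B)\lor\operatorname{Pre}(F)\lor\operatorname{Pre}(A))$. Procedure $\operatorname{Reach}(\mathcal{G})$ for $\mathcal{G}=\langle \mathit{Init},\mathit{Safe},\mathit{Reach},\mathit{Goal}\rangle$: (1) $R:=\mathit{Init}\land\mathit{Goal}$; $I:=\mathit{Init}\land\neg\mathit{Goal}$. (2) If $I$ is unsatisfiable, return $(R,\mathrm{false},\mathrm{false})$. (3) $\varphi:=\operatorname{Interpolate}(I,\mathit{Goal})$; $C:=\operatorname{Instantiate}(\varphi,\mathcal{G})$. (4) If $\operatorname{Enf}(C,\mathcal{G})$ is unsatisfiable, return $(R,\mathrm{false},\mathit{Safe}\land\neg C)$. (5) $\mathcal{G}_{post}:=\langle \operatorname{Post}(C)[\mathcal{V}'/\mathcal{V}],\mathit{Safe}\land\varphi,\mathit{Reach}\land\varphi,\mathit{Goal}\rangle$; $(R_{post},\mathfrak{S}^{post}_{\mathrm{REACH}},\mathfrak{S}^{post}_{\mathrm{SAFE}}):=\operatorname{Reach}(\mathcal{G}_{post})$.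 (6) $F:=C\land R_{post}[\mathcal{V}/\mathcal{V}']$. (7) If $\operatorname{Enf}(F,\mathcal{G})$ is unsatisfiable, return $(R,\mathrm{false},\mathit{Safe}\land\neg F\land(\varphi\Rightarrow\mathfrak{S}^{post}_{\mathrm{SAFE}}))$. (8) If $(\mathit{Reach}\lor\mathit{Safe})\land\varphi\land\neg\varphi[\mathcal{V}/\mathcal{V}']\land\neg\mathit{Goal}$ is satisfiable, set $F:=F\lor\mathit{Goal}[\mathcal{V}/\mathcal{V}']$ and $\varphi:=\mathrm{false}$. (9) $\mathcal{G}_{pre}:=\langle I,\mathit{Safe}\land\neg F,\mathit{Reach}\land\neg F,\operatorname{Pre}(\operatorname{Enf}(F,\mathcal{G}))\rangle$; $(R_{pre},\mathfrak{S}^{pre}_{\mathrm{REACH}},\mathfrak{S}^{pre}_{\mathrm{SAFE}}):=\operatorname{Reach}(\mathcal{G}_{pre})$. (10) Return $(R\lor R_{pre},\ \operatorname{combine}(\mathfrak{S}^{pre}_{\mathrm{REACH}},F,\mathfrak{S}^{post}_{\mathrm{REACH}}),\ (\neg\varphi\Rightarrow\mathfrak{S}^{pre}_{\mathrm{SAFE}})\land(\varphi\Rightarrow\mathfrak{S}^{post}_{\mathrm{SAFE}}))$. *)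

theory Defs
  imports Main
begin

text \<open>The finite set of variables is a finite type \<open>'v\<close>; \<open>Cur v\<close> is the variable \<open>v\<close> itself and
  \<open>Pri v\<close> its primed copy. All values live in one type, which contains the Booleans.\<close>

datatype 'v var = Cur (base: 'v) | Pri (base: 'v)

datatype 'd val = Bool bool | Val 'd

type_synonym ('v, 'd) valuation = "'v var \<Rightarrow> 'd val"

text \<open>A logic is a type \<open>'f\<close> of formulas over the variables and their primed copies, together with
  its satisfaction relation, free variables, and syntactic operations. \<open>Exists X \<phi>\<close> binds all variables
  in \<open>X\<close>; \<open>prime\<close> and \<open>unprime\<close> are the substitutions of $v'$ for $v$ and of $v$ for $v'$,
  simultaneously for all $v$. Formulas are not identified up to equivalence.\<close>

record ('f, 'v, 'd) logic =
  holds :: "('v, 'd) valuation \<Rightarrow> 'f \<Rightarrow> bool"  (infix \<open>\<Turnstile>\<index>\<close> 50)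
  fv :: "'f \<Rightarrow> 'v var set"
  BoolVar :: "'v \<Rightarrow> 'f"
  Bot :: "'f"  (\<open>\<^bold>\<bottom>\<index>\<close>)
  Neg :: "'f \<Rightarrow> 'f"  (\<open>\<^bold>\<not>\<index> _\<close> [80] 80)
  Conj :: "'f \<Rightarrow> 'f \<Rightarrow> 'f"  (infixr \<open>\<^bold>\<and>\<index>\<close> 75)
  Disj :: "'f \<Rightarrow> 'f \<Rightarrow> 'f"  (infixr \<open>\<^bold>\<or>\<index>\<close> 70)
  Imp :: "'f \<Rightarrow> 'f \<Rightarrow> 'f"  (infixr \<open>\<^bold>\<longrightarrow>\<index>\<close> 65)
  Exists :: "'v var set \<Rightarrow> 'f \<Rightarrow> 'f"
  prime :: "'f \<Rightarrow> 'f"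
  unprime :: "'f \<Rightarrow> 'f"

definition in_domains :: "('v \<Rightarrow> 'd val set) \<Rightarrow> ('v, 'd) valuation \<Rightarrow> bool" where
  "in_domains D \<sigma> \<longleftrightarrow> (\<forall>x. \<sigma> x \<in> D (base x))"

text \<open>The free variables of compound formulas are bounded from above only, so that operations may
  simplify their result; in particular \<open>Exists\<close> may perform quantifier elimination.\<close>

locale symbolic_logic =
  fixes L :: "('f, 'v::finite, 'd) logic" (structure)
    and D :: "'v \<Rightarrow> 'd val set"
  assumes coincidence:
      "\<lbrakk>in_domains D \<sigma>; in_domains D \<tau>; \<And>x. x \<in> fv L \<phi> \<Longrightarrow> \<sigma> x = \<tau> x\<rbrakk> \<Longrightarrow> \<sigma> \<Turnstile> \<phi> \<longleftrightarrow> \<tau> \<Turnstile> \<phi>"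
    and holds_BoolVar:
      "\<lbrakk>in_domains D \<sigma>; D v = range Bool\<rbrakk> \<Longrightarrow> \<sigma> \<Turnstile> BoolVar L v \<longleftrightarrow> \<sigma> (Cur v) = Bool True"
    and holds_Bot: "in_domains D \<sigma> \<Longrightarrow> \<not> \<sigma> \<Turnstile> \<^bold>\<bottom>"
    and holds_Neg: "in_domains D \<sigma> \<Longrightarrow> \<sigma> \<Turnstile> \<^bold>\<not> \<phi> \<longleftrightarrow> \<not> \<sigma> \<Turnstile> \<phi>"
    and holds_Conj: "in_domains D \<sigma> \<Longrightarrow> \<sigma> \<Turnstile> \<phi> \<^bold>\<and> \<psi> \<longleftrightarrow> \<sigma> \<Turnstile> \<phi> \<and> \<sigma> \<Turnstile> \<psi>"
    and holds_Disj: "in_domains D \<sigma> \<Longrightarrow> \<sigma> \<Turnstile> \<phi> \<^bold>\<or> \<psi> \<longleftrightarrow> \<sigma> \<Turnstile> \<phi> \<or> \<sigma> \<Turnstile> \<psi>"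
    and holds_Imp: "in_domains D \<sigma> \<Longrightarrow> \<sigma> \<Turnstile> \<phi> \<^bold>\<longrightarrow> \<psi> \<longleftrightarrow> (\<sigma> \<Turnstile> \<phi> \<longrightarrow> \<sigma> \<Turnstile> \<psi>)"
    and holds_Exists: "in_domains D \<sigma> \<Longrightarrow>
      \<sigma> \<Turnstile> Exists L X \<phi> \<longleftrightarrow> (\<exists>\<tau>. in_domains D \<tau> \<and> (\<forall>x. x \<notin> X \<longrightarrow> \<tau> x = \<sigma> x) \<and> \<tau> \<Turnstile> \<phi>)"
    and holds_prime: "in_domains D \<sigma> \<Longrightarrow> \<sigma> \<Turnstile> prime L \<phi> \<longleftrightarrow> (\<lambda>x. \<sigma> (Pri (base x))) \<Turnstile> \<phi>"
    and holds_unprime: "in_domains D \<sigma> \<Longrightarrow> \<sigma> \<Turnstile> unprime L \<phi> \<longleftrightarrow> (\<lambda>x. \<sigma> (Cur (base x))) \<Turnstile> \<phi>"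
    and fv_BoolVar: "fv L (BoolVar L v) \<subseteq> {Cur v}"
    and fv_Bot: "fv L \<^bold>\<bottom> = {}"
    and fv_Neg: "fv L (\<^bold>\<not> \<phi>) \<subseteq> fv L \<phi>"
    and fv_Conj: "fv L (\<phi> \<^bold>\<and> \<psi>) \<subseteq> fv L \<phi> \<union> fv L \<psi>"
    and fv_Disj: "fv L (\<phi> \<^bold>\<or> \<psi>) \<subseteq> fv L \<phi> \<union> fv L \<psi>"
    and fv_Imp: "fv L (\<phi> \<^bold>\<longrightarrow> \<psi>) \<subseteq> fv L \<phi> \<union> fv L \<psi>"
    and fv_Exists: "fv L (Exists L X \<phi>) \<subseteq> fv L \<phi> - X"
    and fv_prime: "fv L (prime L \<phi>) \<subseteq> (\<lambda>x. Pri (base x)) ` fv L \<phi>"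
    and fv_unprime: "fv L (unprime L \<phi>) \<subseteq> (\<lambda>x. Cur (base x)) ` fv L \<phi>"

datatype 'f game = Game (Init: 'f) (Safe: 'f) (Reach: 'f) (Goal: 'f)

context
  fixes L :: "('f, 'v::finite, 'd) logic" (structure)
    and D :: "'v \<Rightarrow> 'd val set"
begin

definition satisfiable :: "'f \<Rightarrow> bool" where
  "satisfiable \<phi> \<longleftrightarrow> (\<exists>\<sigma>. in_domains D \<sigma> \<and> \<sigma> \<Turnstile> \<phi>)"

definition valid :: "'f \<Rightarrow> bool" where
  "valid \<phi> \<longleftrightarrow> (\<forall>\<sigma>. in_domains D \<sigma> \<longrightarrow> \<sigma> \<Turnstile> \<phi>)"

definition state_predicate :: "'f \<Rightarrow> bool" where
  "state_predicate \<phi> \<longleftrightarrow> fv L \<phi> \<subseteq> range Cur"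

text \<open>\<open>Safe\<close> and \<open>Reach\<close> range over \<open>range Cur \<union> range Pri = UNIV\<close>, so being a transition predicate
  imposes no condition on them.\<close>

definition reachability_game :: "'v \<Rightarrow> 'f game \<Rightarrow> bool" where
  "reachability_game r G \<longleftrightarrow>
     state_predicate (Init G) \<and> state_predicate (Goal G) \<and>
     valid (Safe G \<^bold>\<longrightarrow> \<^bold>\<not> BoolVar L r) \<and> valid (Reach G \<^bold>\<longrightarrow> BoolVar L r)"

definition interpolation :: "('f \<Rightarrow> 'f \<Rightarrow> 'f) \<Rightarrow> bool" where
  "interpolation interpolate \<longleftrightarrow>
     (\<forall>\<alpha> \<beta>. \<not> satisfiable (\<alpha> \<^bold>\<and> \<beta>) \<longrightarrow>
        valid (\<beta> \<^bold>\<longrightarrow> interpolate \<alpha> \<beta>) \<and>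
        \<not> satisfiable (interpolate \<alpha> \<beta> \<^bold>\<and> \<alpha>) \<and>
        fv L (interpolate \<alpha> \<beta>) \<subseteq> fv L \<alpha> \<inter> fv L \<beta>)"

definition Pre :: "'f \<Rightarrow> 'f" where
  "Pre T = Exists L (range Pri) T"

definition Post :: "'f \<Rightarrow> 'f" where
  "Post T = Exists L (range Cur) T"

definition Instantiate :: "'f \<Rightarrow> 'f game \<Rightarrow> 'f" where
  "Instantiate \<phi> G = (Safe G \<^bold>\<or> Reach G) \<^bold>\<and> \<^bold>\<not> \<phi> \<^bold>\<and> prime L \<phi>"

definition Enf :: "'f \<Rightarrow> 'f game \<Rightarrow> 'f" where
  "Enf T G = (Safe G \<^bold>\<or> Reach G) \<^bold>\<and> T \<^bold>\<and> \<^bold>\<not> Exists L (range Pri) (Safe G \<^bold>\<and> \<^bold>\<not> T)"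

definition combine :: "'f \<Rightarrow> 'f \<Rightarrow> 'f \<Rightarrow> 'f" where
  "combine A F B =
     (Pre B \<^bold>\<longrightarrow> B) \<^bold>\<and>
     ((\<^bold>\<not> Pre B \<^bold>\<and> Pre F) \<^bold>\<longrightarrow> F) \<^bold>\<and>
     ((\<^bold>\<not> Pre B \<^bold>\<and> \<^bold>\<not> Pre F) \<^bold>\<longrightarrow> A) \<^bold>\<and>
     (Pre B \<^bold>\<or> Pre F \<^bold>\<or> Pre A)"

text \<open>The recursive procedure. Its termination on \<open>G\<close> is \<open>reach_proc_dom L D interpolate G\<close>, the
  accessible part of the call relation generated by the function package.\<close>

context
  fixes interpolate :: "'f \<Rightarrow> 'f \<Rightarrow> 'f"
begin

function (domintros) reach_proc :: "'f game \<Rightarrow> 'f \<times> 'f \<times> 'f" where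
  "reach_proc G =
    (let R = Init G \<^bold>\<and> Goal G;
         I = Init G \<^bold>\<and> \<^bold>\<not> Goal G
     in if \<not> satisfiable I then (R, \<^bold>\<bottom>, \<^bold>\<bottom>)
     else let
         \<phi> = interpolate I (Goal G);
         C = Instantiate \<phi> G
     in if \<not> satisfiable (Enf C G) then (R, \<^bold>\<bottom>, Safe G \<^bold>\<and> \<^bold>\<not> C)
     else let
         (R_post, S_reach_post, S_safe_post) =
           reach_proc (Game (unprime L (Post C)) (Safe G \<^bold>\<and> \<phi>) (Reach G \<^bold>\<and> \<phi>) (Goal G));
         F = C \<^bold>\<and> prime L R_post
     in if \<not> satisfiable (Enf F G)
        then (R, \<^bold>\<bottom>, Safe G \<^bold>\<and> \<^bold>\<not> F \<^bold>\<and> (\<phi> \<^bold>\<longrightarrow> S_safe_post))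
     else let
         (F', \<phi>') =
           (if satisfiable ((Reach G \<^bold>\<or> Safe G) \<^bold>\<and> \<phi> \<^bold>\<and> \<^bold>\<not> prime L \<phi> \<^bold>\<and> \<^bold>\<not> Goal G)
            then (F \<^bold>\<or> prime L (Goal G), \<^bold>\<bottom>)
            else (F, \<phi>));
         (R_pre, S_reach_pre, S_safe_pre) =
           reach_proc (Game I (Safe G \<^bold>\<and> \<^bold>\<not> F') (Reach G \<^bold>\<and> \<^bold>\<not> F') (Pre (Enf F' G)))
     in (R \<^bold>\<or> R_pre,
         combine S_reach_pre F' S_reach_post,
         (\<^bold>\<not> \<phi>' \<^bold>\<longrightarrow> S_safe_pre) \<^bold>\<and> (\<phi>' \<^bold>\<longrightarrow> S_safe_post)))"
  by pat_completeness auto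

end

end

end

theory Submission
  imports Defs
begin

text \<open>Every recursive call keeps a proper subset of the transitions satisfying
  \<open>Safe \<or> Reach\<close>, and over finite domains there are only finitely many. The call on the post game
  drops the transitions where \<open>\<phi>\<close> fails, among them every model of \<open>Enf(C)\<close>; the call on the pre game
  drops the models of \<open>F\<close>, among them every model of \<open>Enf(F)\<close>. Both sets are nonempty because of
  the preceding satisfiability tests, whatever the first recursive call returned.\<close>

lemma finite_valuations:
  fixes D :: "'v::finite \<Rightarrow> 'd val set"
  assumes "\<forall>v. finite (D v)"
  shows "finite {\<sigma> :: ('v, 'd) valuation. in_domains D \<sigma>}"
proof -
  \<comment> \<open>Finiteness is assumed of \<open>'v\<close> only; the two constructor images
    transfer it to \<open>'v var\<close>.\<close>
  have "(UNIV :: 'v var set) \<subseteq> range Cur \<union> range Pri"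
    by (metis UnCI rangeI subsetI var.exhaust)
  then have "finite (UNIV :: 'v var set)"
    by (rule finite_subset) simp
  moreover have "finite (\<Union>v. D v)"
    using assms by simp
  \<comment> \<open>Over \<open>UNIV\<close> the default value \<open>undefined\<close> constrains
    nothing, so this is the finite space of all functions into the union of the domains.\<close>
  ultimately have "finite {\<sigma> :: ('v, 'd) valuation.
      \<forall>x. (x \<in> UNIV \<longrightarrow> \<sigma> x \<in> (\<Union>v. D v)) \<and> (x \<notin> UNIV \<longrightarrow> \<sigma> x = undefined)}"
    by (rule finite_set_of_finite_funs)
  then show ?thesis
    by (rule rev_finite_subset) (auto simp: in_domains_def)
qed

text \<open>A semantic set serves as the termination measure because the formulas themselves grow
  along the recursion. A valuation of plain and primed variables is a pair of states.\<close>

definition transitions ::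
    "('f, 'v::finite, 'd) logic \<Rightarrow> ('v \<Rightarrow> 'd val set) \<Rightarrow> 'f game \<Rightarrow> ('v, 'd) valuation set" where
  "transitions L D G =
     {\<sigma>. in_domains D \<sigma> \<and> (holds L \<sigma> (Safe G) \<or> holds L \<sigma> (Reach G))}"

context symbolic_logic
begin

lemma satisfiable_EnfE:
  assumes "satisfiable L D (Enf L T G)"
  obtains \<sigma> where "\<sigma> \<in> transitions L D G" "\<sigma> \<Turnstile> T"
proof -
  obtain \<sigma> where "in_domains D \<sigma>" "\<sigma> \<Turnstile> Enf L T G"
    using assms by (auto simp: satisfiable_def)
  then have "\<sigma> \<in> transitions L D G" "\<sigma> \<Turnstile> T"
    by (auto simp: Enf_def transitions_def holds_Conj holds_Disj)
  then show thesis
    by (rule that)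
qed

text \<open>Both recursive calls conjoin one formula to \<open>Safe\<close> and
  \<open>Reach\<close>: \<phi> for the post game, the negation of \<open>F'\<close> for the pre
  game. The transition \<sigma> witnesses strictness.\<close>

lemma transitions_restrict_psubset:
  assumes "\<sigma> \<in> transitions L D G" "\<not> \<sigma> \<Turnstile> \<psi>"
  shows "transitions L D (Game I (Safe G \<^bold>\<and> \<psi>) (Reach G \<^bold>\<and> \<psi>) H) \<subset> transitions L D G"
proof (rule psubsetI)
  show "transitions L D (Game I (Safe G \<^bold>\<and> \<psi>) (Reach G \<^bold>\<and> \<psi>) H) \<subseteq> transitions L D G"
    by (auto simp: transitions_def holds_Conj)
  have "\<sigma> \<notin> transitions L D (Game I (Safe G \<^bold>\<and> \<psi>) (Reach G \<^bold>\<and> \<psi>) H)"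
    using assms(2) by (auto simp: transitions_def holds_Conj)
  with assms(1) show "transitions L D (Game I (Safe G \<^bold>\<and> \<psi>) (Reach G \<^bold>\<and> \<psi>) H) \<noteq> transitions L D G"
    by blast
qed

text \<open>\<open>Instantiate\<close> has the negation of \<phi> as a conjunct, so the witness from
  \<open>Enf\<close> is lost.\<close>

lemma transitions_post_psubset:
  assumes "satisfiable L D (Enf L (Instantiate L \<phi> G) G)"
  shows "transitions L D (Game I (Safe G \<^bold>\<and> \<phi>) (Reach G \<^bold>\<and> \<phi>) H) \<subset> transitions L D G"
proof -
  obtain \<sigma> where "\<sigma> \<in> transitions L D G" "\<sigma> \<Turnstile> Instantiate L \<phi> G"
    using assms by (rule satisfiable_EnfE)
  then show ?thesis
    by (intro transitions_restrict_psubset)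
      (auto simp: Instantiate_def transitions_def holds_Conj holds_Neg)
qed

text \<open>\<open>F'\<close> is kept apart from \<open>F\<close> because the procedure may weaken
  \<open>F\<close> by the primed goal after testing \<open>Enf\<close> of \<open>F\<close>. A model
  of \<open>F\<close> still satisfies \<open>F'\<close> and is removed.\<close>

lemma transitions_pre_psubset:
  assumes "satisfiable L D (Enf L F G)"
    and "\<And>\<sigma>. in_domains D \<sigma> \<Longrightarrow> \<sigma> \<Turnstile> F \<Longrightarrow> \<sigma> \<Turnstile> F'"
  shows "transitions L D (Game I (Safe G \<^bold>\<and> \<^bold>\<not> F') (Reach G \<^bold>\<and> \<^bold>\<not> F') H) \<subset> transitions L D G"
proof -
  obtain \<sigma> where "\<sigma> \<in> transitions L D G" "\<sigma> \<Turnstile> F"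
    using assms(1) by (rule satisfiable_EnfE)
  then show ?thesis
    using assms(2) by (intro transitions_restrict_psubset)
      (auto simp: transitions_def holds_Neg)
qed

lemma reach_proc_terminates:
  assumes "\<forall>v. finite (D v)"
  shows "reach_proc_dom L D interpolate G"
proof (induction "card (transitions L D G)" arbitrary: G rule: less_induct)
  case less
  have "finite (transitions L D G)"
    by (rule finite_subset[OF _ finite_valuations[OF assms]]) (auto simp: transitions_def)
  then have IH: "reach_proc_dom L D interpolate G'"
    if "transitions L D G' \<subset> transitions L D G" for G'
    using less that by (simp add: psubset_card_mono)
  show ?case
  proof (rule reach_proc.domintros, goal_cases)
    case 1
    then show ?case
      by (intro IH transitions_post_psubset)
  next
    case 2
    \<comment> \<open>\<open>enf\<close> is the passed test on \<open>F\<close>; \<open>F'\<close>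
      is the case distinction defining the new formula, which is either \<open>F\<close> or a
      disjunction containing it.\<close>
    note enf = 2(5) and F' = 2(7)
    show ?case
      by (rule IH, rule transitions_pre_psubset[OF enf])
        (use F' in \<open>auto simp: holds_Disj split: if_splits\<close>)
  qed
qed

end

theorem theorem2:
  fixes L :: "('f, 'v::finite, 'd) logic"
    and D :: "'v \<Rightarrow> 'd val set"
    and r :: 'v
    and interpolate :: "'f \<Rightarrow> 'f \<Rightarrow> 'f"
    and G :: "'f game"
  assumes "symbolic_logic L D"
    and "D r = range Bool"
    and "interpolation L D interpolate"
    and "reachability_game L D r G"
    and "\<forall>v. finite (D v)"
  shows "reach_proc_dom L D interpolate G"
  using symbolic_logic.reach_proc_terminates[OF assms(1,5)] .

end
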